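(* Fix $\beta>0$ and consider the length distribution function $\nu(\ell)=(\ell-1)^{\beta-1}$ for $\ell>1$ (and $\nu(\ell)=0$ for $\ell<1$). Let $\Xi(\beta)$ be the unique positive solution $\theta$ of $\mathbf{B}(\beta+1,\theta+1)=\frac{1}{2(\beta+1)}$. Then in the $\nu$-RSA process, for all $\varepsilon>0$, $$L^{\Xi(\beta)-\varepsilon}\ll\mathbb{E}[S_L]\le L^{\Xi(\beta)},$$ where the upper bound holds for all $L>0$.
   Context: $\mathbf{B}(z_1,z_2)=\int_0^1t^{z_1-1}(1-t)^{z_2-1}\,dt$ is the Beta function. $f\ll g$ means $\lim_{L\to\infty}f(L)/g(L)=0$. A length distribution function (ldf) is a nonnegative function $\nu$ on $[0,\infty)$, integrable on bounded intervals, with $\nu(\ell)=0$ for $\ell\in[0,1)$ and $\int_1^\ell\nu(t)\,dt>0$ for all $\ell>1$. Its normalizing constant is $Z_\nu(L)=\int_0^L\nu(\ell)\,d\ell$. $\nu$-RSA process on $[0,L]$ ($L>1$): start with $I_0=[0,L]$. At each time $T=1,2,\dots$, independently of the past, sample $b$ uniformly from $[0,L]$ and, independently, a length $\ell\in[1,L]$ with density $\nu(\ell)/Z_\nu(L)$. If $(b,b+\ell)\subseteq I_{T-1}$, the segment is parked and $I_T=I_{T-1}\setminus(b,b+\ell)$; otherwise $I_T=I_{T-1}$. The empty space at saturation is $S_L=\lim_{T\to\infty}\lambda(I_T)$, where $\lambda$ is Lebesgue measure. For $0\le L\le 1$ no segment is parked and $S_L=L$. *)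

theory Defs
  imports "HOL-Probability.Probability" "HOL-Library.Landau_Symbols"
begin

definition length_distribution :: "(real \<Rightarrow> real) \<Rightarrow> bool" where
  "length_distribution nu \<longleftrightarrow>
     (\<forall>l\<ge>0. nu l \<ge> 0) \<and>
     (\<forall>b\<ge>0. set_integrable lborel {0..b} nu) \<and>
     (\<forall>l\<in>{0..<1}. nu l = 0) \<and>
     (\<forall>l>1. (LBINT t:{1..l}. nu t) > 0)"

definition normalizing_constant :: "(real \<Rightarrow> real) \<Rightarrow> real \<Rightarrow> real" where
  "normalizing_constant nu L = (LBINT l:{0..L}. nu l)"

definition length_measure :: "(real \<Rightarrow> real) \<Rightarrow> real \<Rightarrow> real measure" where
  "length_measure nu L =
     density lborel (\<lambda>l. ennreal (indicator {1..L} l * (nu l / normalizing_constant nu L)))"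

text \<open>Law of an i.i.d. sequence of pairs (left end point, length). This is a probability measure
  when \<open>L > 1\<close> and \<open>nu\<close> is a length distribution function.\<close>

definition rsa_measure :: "(real \<Rightarrow> real) \<Rightarrow> real \<Rightarrow> (nat \<Rightarrow> real \<times> real) measure" where
  "rsa_measure nu L =
     Pi\<^sub>M UNIV (\<lambda>_. uniform_measure lborel {0..L} \<Otimes>\<^sub>M length_measure nu L)"

text \<open>The pair \<open>\<omega> T\<close> (indexed from 0) is the sample drawn at time \<open>Suc T\<close>.\<close>

primrec vacant :: "real \<Rightarrow> (nat \<Rightarrow> real \<times> real) \<Rightarrow> nat \<Rightarrow> real set" where
  "vacant L \<omega> 0 = {0..L}"
| "vacant L \<omega> (Suc T) =
     (let (b, l) = \<omega> T in
      if {b<..<b + l} \<subseteq> vacant L \<omega> T then vacant L \<omega> T - {b<..<b + l} else vacant L \<omega> T)"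

definition saturation_space :: "real \<Rightarrow> (nat \<Rightarrow> real \<times> real) \<Rightarrow> real" where
  "saturation_space L \<omega> = lim (\<lambda>T. measure lborel (vacant L \<omega> T))"

text \<open>The expectation of \<open>S\<^sub>L\<close>. For \<open>L \<le> 1\<close> nothing is parked and
  there is no sampling law (the normalizing constant is 0), whence the case distinction.\<close>

definition expected_space :: "(real \<Rightarrow> real) \<Rightarrow> real \<Rightarrow> real" where
  "expected_space nu L =
     (if L \<le> 1 then L else (\<integral>\<omega>. saturation_space L \<omega> \<partial>rsa_measure nu L))"

text \<open>The value at \<open>l = 1\<close>, where the formula is singular for \<open>\<beta> < 1\<close>, is set to 0; a single point
  does not affect the process.\<close>

definition power_ldf :: "real \<Rightarrow> real \<Rightarrow> real" where
  "power_ldf \<beta> l = (if l > 1 then (l - 1) powr (\<beta> - 1) else 0)"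

text \<open>The library's \<open>Beta\<close> is a quotient of Gamma values; it agrees with the Beta integral for
  positive real arguments by \<open>has_integral_Beta_real\<close>.\<close>

definition is_exponent :: "real \<Rightarrow> real \<Rightarrow> bool" where
  "is_exponent \<beta> \<theta> \<longleftrightarrow> \<theta> > 0 \<and> Beta (\<beta> + 1) (\<theta> + 1) = 1 / (2 * (\<beta> + 1))"

definition Xi :: "real \<Rightarrow> real" where
  "Xi \<beta> = (THE \<theta>. is_exponent \<beta> \<theta>)"

end

theory Submission
  imports Defs "HOL-Real_Asymp.Real_Asymp"
begin

text \<open>
  A process run inside \<open>[x, y] \<subseteq> [0, L]\<close> that accepts its first segment \<open>(b, b + l)\<close> splits
  into the processes in \<open>[x, b]\<close> and \<open>[b + l, y]\<close>, driven by the same later samples. Only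
  expectations are needed, so the dependence of the two halves is harmless, and conditioning on the
  first sample gives, for the mean final vacancy \<open>G\<close> of an interval of length \<open>s + 1 > 1\<close>,
  \<open>G (s + 1) * (s powr (\<beta> + 1) / (\<beta> + 1)) = 2 * (integral over u in [0, s] of G u * (s - u) powr \<beta>)\<close>.
  Inserting \<open>u powr \<theta>\<close> on the right yields a Beta integral, and the factor
  \<open>2 * (\<beta> + 1) * Beta (\<beta> + 1) (\<theta> + 1)\<close> is 1 at \<open>\<theta> = \<Xi>(\<beta>)\<close> and exceeds 1 below it. Hence \<open>u powr \<Xi>(\<beta>)\<close>
  is a supersolution, and \<open>c * u powr \<theta>\<close> with \<open>\<theta> < \<Xi>(\<beta>)\<close> is a subsolution for large lengths; both
  comparisons go by induction on the length, rounded up.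
\<close>

subsection \<open>Splitting the process at the first parked segment\<close>

text \<open>Stated for an arbitrary vacant set, so that the process can be restarted from what the
  first segment leaves. A segment of nonpositive length is empty and changes nothing.\<close>

definition park :: "real set \<Rightarrow> real \<times> real \<Rightarrow> real set" where
  "park V p = (if {fst p<..<fst p + snd p} \<subseteq> V then V - {fst p<..<fst p + snd p} else V)"

primrec vacant_from :: "real set \<Rightarrow> (nat \<Rightarrow> real \<times> real) \<Rightarrow> nat \<Rightarrow> real set" where
  "vacant_from V \<omega> 0 = V"
| "vacant_from V \<omega> (Suc T) = park (vacant_from V \<omega> T) (\<omega> T)"

lemma vacant_eq_vacant_from: "vacant L \<omega> T = vacant_from {0..L} \<omega> T"
  by (induction T) (auto simp: park_def Let_def split: prod.split)

text \<open>The primitive recursion peels off the last sample; conditioning needs the first one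
  peeled off, with the other samples shifted.\<close>

lemma vacant_from_Suc_front:
  "vacant_from V \<omega> (Suc T) = vacant_from (park V (\<omega> 0)) (\<lambda>n. \<omega> (Suc n)) T"
  by (induction T) auto

lemma vacant_from_subset: "vacant_from V \<omega> T \<subseteq> V"
  by (induction T) (auto simp: park_def)

lemma vacant_from_sets:
  assumes "V \<in> sets borel"
  shows "vacant_from V \<omega> T \<in> sets borel"
  using assms by (induction T) (auto simp: park_def)

text \<open>An interval is connected, so it cannot meet both sides of the gap between
  \<open>u\<close> and \<open>v\<close>: it would contain the midpoint of the gap.\<close>

lemma interval_subset_separated_Un:
  fixes p q u v :: real
  assumes "A \<subseteq> {..u}" "B \<subseteq> {v..}" "u < v" "{p<..<q} \<subseteq> A \<union> B"
  shows "{p<..<q} \<subseteq> A \<or> {p<..<q} \<subseteq> B"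
proof (rule ccontr)
  assume "\<not> ?thesis"
  then obtain a b where a: "a \<in> {p<..<q}" "a \<notin> B" and b: "b \<in> {p<..<q}" "b \<notin> A"
    by blast
  with assms(4) have "a \<in> A" "b \<in> B"
    by blast+
  with assms(1-3) have "a \<le> u" "v \<le> b"
    by auto
  with a b \<open>u < v\<close> have "(u + v) / 2 \<in> {p<..<q}"
    by auto
  then have "(u + v) / 2 \<in> A \<union> B"
    using assms(4) by blast
  with assms(1-3) show False
    by (auto dest!: subsetD)
qed

lemma park_Un:
  assumes "A \<subseteq> {..u}" "B \<subseteq> {v..}" "u < v"
  shows "park (A \<union> B) p = park A p \<union> park B p"
proof -
  define I where "I = {fst p<..<fst p + snd p}"
  have AB: "A \<inter> B = {}"
    using assms by force
  have *: "I \<subseteq> A \<union> B \<longleftrightarrow> I \<subseteq> A \<or> I \<subseteq> B"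
    using interval_subset_separated_Un[OF assms, of "fst p" "fst p + snd p"]
    by (auto simp: I_def)
  show ?thesis
    unfolding park_def I_def[symmetric] * using AB by auto
qed

text \<open>Vacant sets only shrink, so the gap persists and every later segment fits into at most
  one piece without touching the other, unless it is empty.\<close>

lemma vacant_from_Un:
  assumes "A \<subseteq> {..u}" "B \<subseteq> {v..}" "u < v"
  shows "vacant_from (A \<union> B) \<omega> T = vacant_from A \<omega> T \<union> vacant_from B \<omega> T"
proof (induction T)
  case (Suc T)
  have "vacant_from A \<omega> T \<subseteq> {..u}" "vacant_from B \<omega> T \<subseteq> {v..}"
    using vacant_from_subset assms by blast+
  from park_Un[OF this \<open>u < v\<close>] show ?case
    by (simp add: Suc)
qed simp

text \<open>Positive length is required, although \<open>park\<close> also accepts empty segments: a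
  nonpositive length would split the interval into touching or overlapping pieces while nothing is
  parked.\<close>

definition fits :: "real \<Rightarrow> real \<Rightarrow> real \<times> real \<Rightarrow> bool" where
  "fits x y p \<longleftrightarrow> 0 < snd p \<and> x \<le> fst p \<and> fst p + snd p \<le> y"

text \<open>The vacant length as a recursion on real end points, unrolled from the first sample.
  Measurability and conditioning are direct in this form.\<close>

primrec vacancy :: "nat \<Rightarrow> real \<Rightarrow> real \<Rightarrow> (nat \<Rightarrow> real \<times> real) \<Rightarrow> real" where
  "vacancy 0 x y \<omega> = y - x"
| "vacancy (Suc T) x y \<omega> =
     (if fits x y (\<omega> 0)
      then vacancy T x (fst (\<omega> 0)) (\<lambda>n. \<omega> (Suc n))
         + vacancy T (fst (\<omega> 0) + snd (\<omega> 0)) y (\<lambda>n. \<omega> (Suc n))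
      else vacancy T x y (\<lambda>n. \<omega> (Suc n)))"

lemma park_interval_fits:
  assumes "fits x y p"
  shows "park {x..y} p = {x..fst p} \<union> {fst p + snd p..y}"
  using assms unfolding fits_def park_def by auto

lemma park_interval_not_fits:
  assumes "\<not> fits x y p"
  shows "park {x..y} p = {x..y}"
proof (cases "snd p > 0")
  case True
  with assms have "\<not> {fst p<..<fst p + snd p} \<subseteq> {x..y}"
    by (auto simp: fits_def greaterThanLessThan_subseteq_atLeastAtMost_iff)
  then show ?thesis
    by (simp add: park_def)
qed (auto simp: park_def)

text \<open>After the first parked segment the vacant set is a disjoint union of two sets that
  evolve separately, so their finite measures add up as in the recursion.\<close>

lemma measure_vacant_from:
  assumes "x \<le> y"
  shows "measure lborel (vacant_from {x..y} \<omega> T) = vacancy T x y \<omega>"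
  using assms
proof (induction T arbitrary: x y \<omega>)
  case (Suc T)
  show ?case
  proof (cases "fits x y (\<omega> 0)")
    case True
    define u v \<omega>' where "u = fst (\<omega> 0)" and "v = fst (\<omega> 0) + snd (\<omega> 0)"
      and "\<omega>' = (\<lambda>n. \<omega> (Suc n))"
    have uv: "x \<le> u" "u < v" "v \<le> y"
      using True by (auto simp: fits_def u_def v_def)
    have park: "park {x..y} (\<omega> 0) = {x..u} \<union> {v..y}"
      using park_interval_fits[OF True] by (simp add: u_def v_def)
    have eq: "vacant_from {x..y} \<omega> (Suc T) = vacant_from {x..u} \<omega>' T \<union> vacant_from {v..y} \<omega>' T"
      unfolding vacant_from_Suc_front park \<omega>'_def[symmetric]
      by (rule vacant_from_Un[of _ u _ v]) (use uv in auto)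
    have sub: "vacant_from {x..u} \<omega>' T \<subseteq> {x..u}" "vacant_from {v..y} \<omega>' T \<subseteq> {v..y}"
      by (rule vacant_from_subset)+
    have S: "vacant_from {x..u} \<omega>' T \<in> sets borel" "vacant_from {v..y} \<omega>' T \<in> sets borel"
      by (rule vacant_from_sets; simp)+
    have "emeasure lborel (vacant_from {x..u} \<omega>' T) \<le> emeasure lborel {x..u}"
      "emeasure lborel (vacant_from {v..y} \<omega>' T) \<le> emeasure lborel {v..y}"
      by (rule emeasure_mono; use sub in simp)+
    then have "emeasure lborel (vacant_from {x..u} \<omega>' T) \<noteq> \<infinity>"
      "emeasure lborel (vacant_from {v..y} \<omega>' T) \<noteq> \<infinity>"
      using uv by (auto simp: top_unique)
    then have "measure lborel (vacant_from {x..y} \<omega> (Suc T)) =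
      measure lborel (vacant_from {x..u} \<omega>' T) + measure lborel (vacant_from {v..y} \<omega>' T)"
      unfolding eq using S sub uv by (intro measure_Union) force+
    also have "\<dots> = vacancy T x u \<omega>' + vacancy T v y \<omega>'"
      using Suc.IH uv by simp
    finally show ?thesis
      using True by (simp add: u_def v_def \<omega>'_def)
  next
    case False
    then show ?thesis
      using Suc.IH[OF \<open>x \<le> y\<close>, of "\<lambda>n. \<omega> (Suc n)"]
      unfolding vacant_from_Suc_front park_interval_not_fits[OF False] by simp
  qed
qed simp

lemma measure_vacant:
  assumes "0 \<le> L"
  shows "measure lborel (vacant L \<omega> T) = vacancy T 0 L \<omega>"
  unfolding vacant_eq_vacant_from using assms by (rule measure_vacant_from)

lemma vacancy_nonneg:
  "x \<le> y \<Longrightarrow> 0 \<le> vacancy T x y \<omega>"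
  by (induction T arbitrary: x y \<omega>) (auto simp: fits_def)

text \<open>By induction from the front, the comparison at \<open>T\<close> for the remainders gives
  the one at \<open>Suc T\<close>; only the base case sees a segment being removed.\<close>

lemma vacancy_Suc_le:
  "x \<le> y \<Longrightarrow> vacancy (Suc T) x y \<omega> \<le> vacancy T x y \<omega>"
proof (induction T arbitrary: x y \<omega>)
  case (Suc T)
  show ?case
  proof (cases "fits x y (\<omega> 0)")
    case True
    then have "x \<le> fst (\<omega> 0)" "fst (\<omega> 0) + snd (\<omega> 0) \<le> y"
      by (auto simp: fits_def)
    from Suc.IH[OF this(1), of "\<lambda>n. \<omega> (Suc n)"] Suc.IH[OF this(2), of "\<lambda>n. \<omega> (Suc n)"] True show ?thesis
      by (simp only: vacancy.simps(2)[of "Suc T"] vacancy.simps(2)[of T x y] if_True)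
  next
    case False
    then show ?thesis
      using Suc.IH[OF Suc.prems, of "\<lambda>n. \<omega> (Suc n)"]
      by (simp only: vacancy.simps(2)[of "Suc T"] vacancy.simps(2)[of T x y] if_False)
  qed
qed (auto simp: fits_def)

definition final_vacancy :: "real \<Rightarrow> real \<Rightarrow> (nat \<Rightarrow> real \<times> real) \<Rightarrow> real" where
  "final_vacancy x y \<omega> = lim (\<lambda>T. vacancy T x y \<omega>)"

lemma vacancy_tendsto:
  assumes "x \<le> y"
  shows "(\<lambda>T. vacancy T x y \<omega>) \<longlonglongrightarrow> final_vacancy x y \<omega>"
proof -
  have "decseq (\<lambda>T. vacancy T x y \<omega>)"
    by (rule decseq_SucI) (rule vacancy_Suc_le[OF assms])
  then obtain l where "(\<lambda>T. vacancy T x y \<omega>) \<longlonglongrightarrow> l"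
    using decseq_convergent[of "\<lambda>T. vacancy T x y \<omega>" 0] vacancy_nonneg[OF assms] by metis
  then show ?thesis
    unfolding final_vacancy_def using limI by metis
qed

lemma final_vacancy_nonneg: "x \<le> y \<Longrightarrow> 0 \<le> final_vacancy x y \<omega>"
  using LIMSEQ_le_const[OF vacancy_tendsto] vacancy_nonneg by blast

lemma final_vacancy_le:
  assumes "x \<le> y"
  shows "final_vacancy x y \<omega> \<le> y - x"
proof (rule LIMSEQ_le_const2[OF vacancy_tendsto[OF assms]])
  have "vacancy T x y \<omega> \<le> y - x" for T
  proof (induction T)
    case (Suc T)
    with vacancy_Suc_le[OF assms, of T \<omega>] show ?case
      by linarith
  qed simp
  then show "\<exists>N. \<forall>n\<ge>N. vacancy n x y \<omega> \<le> y - x"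
    by blast
qed

text \<open>Unroll the first sample in \<open>vacancy (Suc T)\<close> and let \<open>T\<close> tend
  to infinity; the shifted sequence has the same limit.\<close>

lemma final_vacancy_rec:
  assumes "x \<le> y"
  shows "final_vacancy x y \<omega> =
    (if fits x y (\<omega> 0)
     then final_vacancy x (fst (\<omega> 0)) (\<lambda>n. \<omega> (Suc n))
        + final_vacancy (fst (\<omega> 0) + snd (\<omega> 0)) y (\<lambda>n. \<omega> (Suc n))
     else final_vacancy x y (\<lambda>n. \<omega> (Suc n)))" (is "_ = ?R")
proof (rule LIMSEQ_unique)
  show "(\<lambda>T. vacancy (Suc T) x y \<omega>) \<longlonglongrightarrow> final_vacancy x y \<omega>"
    using vacancy_tendsto[OF assms] by (rule LIMSEQ_Suc)
  show "(\<lambda>T. vacancy (Suc T) x y \<omega>) \<longlonglongrightarrow> ?R"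
    using assms by (auto simp: fits_def intro!: tendsto_add vacancy_tendsto)
qed

lemma final_vacancy_short:
  assumes "x \<le> y" "y - x < 1" "\<And>n. 1 \<le> snd (\<omega> n)"
  shows "final_vacancy x y \<omega> = y - x"
proof -
  have "vacancy T x y \<omega> = y - x" for T
    using assms
  proof (induction T arbitrary: \<omega>)
    case (Suc T)
    from Suc.prems(2) Suc.prems(3)[of 0] have "\<not> fits x y (\<omega> 0)"
      by (auto simp: fits_def)
    then show ?case
      using Suc.IH[of "\<lambda>n. \<omega> (Suc n)"] Suc.prems by simp
  qed simp
  then show ?thesis
    by (simp add: final_vacancy_def)
qed

lemma saturation_space_eq:
  "0 \<le> L \<Longrightarrow> saturation_space L \<omega> = final_vacancy 0 L \<omega>"
  by (simp add: saturation_space_def final_vacancy_def measure_vacant)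

section \<open>Measurability in the end points and the samples\<close>

abbreviation samples :: "(nat \<Rightarrow> real \<times> real) measure" where
  "samples \<equiv> Pi\<^sub>M UNIV (\<lambda>_. borel \<Otimes>\<^sub>M borel)"

lemma pred_fits [measurable]:
  assumes [measurable]: "f \<in> borel_measurable M" "g \<in> borel_measurable M"
    "h \<in> measurable M (borel \<Otimes>\<^sub>M borel)"
  shows "Measurable.pred M (\<lambda>z. fits (f z) (g z) (h z))"
  unfolding fits_def by measurable

text \<open>The end points are measurable functions as well, since the recursion passes on end
  points that depend on the first sample.\<close>

lemma measurable_vacancy [measurable]:
  assumes "f \<in> borel_measurable M" "g \<in> borel_measurable M" "h \<in> measurable M samples"
  shows "(\<lambda>z. vacancy T (f z) (g z) (h z)) \<in> borel_measurable M"
  using assms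
proof (induction T arbitrary: f g h)
  case 0
  then show ?case
    by simp
next
  case (Suc T)
  note [measurable] = Suc.prems
  have h [measurable]: "(\<lambda>z. h z n) \<in> measurable M (borel \<Otimes>\<^sub>M borel)" for n
    by (rule measurable_compose[OF Suc.prems(3)]) (rule measurable_component_singleton, simp)
  have [measurable]: "(\<lambda>z n. h z (Suc n)) \<in> measurable M samples"
    by (rule measurable_PiM_single') (auto intro: h simp: space_pair_measure)
  have [measurable]: "(\<lambda>z. fst (h z 0)) \<in> borel_measurable M" "(\<lambda>z. snd (h z 0)) \<in> borel_measurable M"
    by measurable
  have [measurable]: "(\<lambda>z. vacancy T (f z) (fst (h z 0)) (\<lambda>n. h z (Suc n))) \<in> borel_measurable M"
    "(\<lambda>z. vacancy T (fst (h z 0) + snd (h z 0)) (g z) (\<lambda>n. h z (Suc n))) \<in> borel_measurable M"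
    "(\<lambda>z. vacancy T (f z) (g z) (\<lambda>n. h z (Suc n))) \<in> borel_measurable M"
    by (rule Suc.IH; measurable)+
  show ?case
    by simp
qed

lemma measurable_final_vacancy [measurable]:
  assumes [measurable]: "f \<in> borel_measurable M" "g \<in> borel_measurable M" "h \<in> measurable M samples"
  shows "(\<lambda>z. final_vacancy (f z) (g z) (h z)) \<in> borel_measurable M"
  unfolding final_vacancy_def by measurable

subsection \<open>The mean final vacancy\<close>

lemma power_ldf_nonneg: "0 \<le> power_ldf \<beta> l"
  by (simp add: power_ldf_def)

lemma measurable_power_ldf [measurable]: "power_ldf \<beta> \<in> borel_measurable borel"
  unfolding power_ldf_def by measurable

text \<open>A shift by 1 turns the density into a pure power. The lower limit \<open>a\<close> is
  flexible because the density vanishes up to 1; both 0 and 1 occur.\<close>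

lemma nn_integral_power_ldf:
  assumes "\<beta> > 0" "s \<ge> 1" "a \<le> 1"
  shows "(\<integral>\<^sup>+l. ennreal (power_ldf \<beta> l) * indicator {a..s} l \<partial>lborel) = ennreal ((s - 1) powr \<beta> / \<beta>)"
proof -
  have "(\<integral>\<^sup>+l. ennreal (power_ldf \<beta> l) * indicator {a..s} l \<partial>lborel) =
      (\<integral>\<^sup>+l. ennreal (power_ldf \<beta> (1 + 1 * l)) * indicator {a..s} (1 + 1 * l) \<partial>lborel)"
    by (subst nn_integral_real_affine[where t = 1 and c = 1]) auto
  also have "\<dots> = (\<integral>\<^sup>+l. ennreal (l powr (\<beta> - 1)) * indicator {0..s - 1} l \<partial>lborel)"
    using assms by (intro nn_integral_cong) (auto simp: power_ldf_def indicator_def)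
  also have "\<dots> = ennreal ((s - 1) powr (\<beta> - 1 + 1) / (\<beta> - 1 + 1))"
    by (rule nn_integral_has_integral_lebesgue'[OF _ has_integral_powr_from_0]) (use assms in auto)
  finally show ?thesis
    by simp
qed

lemma set_integrable_power_ldf:
  assumes "\<beta> > 0" "a \<le> 1"
  shows "set_integrable lborel {a..s} (power_ldf \<beta>)"
proof -
  \<comment> \<open>The closed form is available from \<open>s = 1\<close> on; enlarging the
    interval covers smaller \<open>s\<close>.\<close>
  have "set_integrable lborel {a..max s 1} (power_ldf \<beta>)"
    unfolding set_integrable_def
  proof (rule integrableI_nonneg)
    have "(\<integral>\<^sup>+x. ennreal (indicator {a..max s 1} x *\<^sub>R power_ldf \<beta> x) \<partial>lborel) =
        (\<integral>\<^sup>+l. ennreal (power_ldf \<beta> l) * indicator {a..max s 1} l \<partial>lborel)"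
      by (intro nn_integral_cong) (auto simp: indicator_def)
    then show "(\<integral>\<^sup>+x. ennreal (indicator {a..max s 1} x *\<^sub>R power_ldf \<beta> x) \<partial>lborel) < \<infinity>"
      using nn_integral_power_ldf[of \<beta> "max s 1" a] assms by simp
  qed (auto simp: power_ldf_nonneg)
  then show ?thesis
    by (rule set_integrable_subset) auto
qed

lemma set_integral_power_ldf:
  assumes "\<beta> > 0" "s \<ge> 1" "a \<le> 1"
  shows "(LBINT l:{a..s}. power_ldf \<beta> l) = (s - 1) powr \<beta> / \<beta>"
proof -
  have "(\<integral>\<^sup>+x. ennreal (indicator {a..s} x *\<^sub>R power_ldf \<beta> x) \<partial>lborel) =
      (\<integral>\<^sup>+l. ennreal (power_ldf \<beta> l) * indicator {a..s} l \<partial>lborel)"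
    by (intro nn_integral_cong) (auto simp: indicator_def)
  then show ?thesis
    unfolding set_lebesgue_integral_def using assms
    by (subst integral_eq_nn_integral) (auto simp: power_ldf_nonneg nn_integral_power_ldf)
qed

lemma length_distribution_power_ldf:
  assumes "\<beta> > 0"
  shows "length_distribution (power_ldf \<beta>)"
  unfolding length_distribution_def
  using assms set_integrable_power_ldf[of \<beta> 0] set_integral_power_ldf[of \<beta> _ 1]
  by (auto simp: power_ldf_nonneg) (simp add: power_ldf_def)

lemma normalizing_constant_power_ldf:
  "\<beta> > 0 \<Longrightarrow> 1 \<le> L \<Longrightarrow> normalizing_constant (power_ldf \<beta>) L = (L - 1) powr \<beta> / \<beta>"
  unfolding normalizing_constant_def by (rule set_integral_power_ldf) auto

section \<open>The law of a single sample\<close>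

locale power_rsa =
  fixes \<beta> L :: real
  assumes \<beta>_pos: "\<beta> > 0" and L_gt_1: "L > 1"
begin

definition Z :: real where
  "Z = (L - 1) powr \<beta> / \<beta>"

definition sample :: "(real \<times> real) measure" where
  "sample = uniform_measure lborel {0..L} \<Otimes>\<^sub>M length_measure (power_ldf \<beta>) L"

lemma Z_pos: "Z > 0"
  unfolding Z_def using \<beta>_pos L_gt_1 by simp

lemma sets_length_measure: "sets (length_measure (power_ldf \<beta>) L) = sets borel"
  by (simp add: length_measure_def)

lemma sets_sample: "sets sample = sets (borel \<Otimes>\<^sub>M borel)"
  unfolding sample_def by (intro sets_pair_measure_cong) (simp_all add: sets_length_measure)

lemma nn_integral_length_measure:
  assumes [measurable]: "h \<in> borel_measurable borel"
  shows "(\<integral>\<^sup>+l. h l \<partial>length_measure (power_ldf \<beta>) L) =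
    ennreal (1 / Z) * (\<integral>\<^sup>+l. h l * (ennreal (power_ldf \<beta> l) * indicator {1..L} l) \<partial>lborel)"
proof -
  have scale: "ennreal (power_ldf \<beta> l / Z) = ennreal (1 / Z) * ennreal (power_ldf \<beta> l)" for l
    using Z_pos by (subst ennreal_mult[symmetric]) (auto simp: power_ldf_nonneg)
  have "(\<integral>\<^sup>+l. h l \<partial>length_measure (power_ldf \<beta>) L) =
      (\<integral>\<^sup>+l. ennreal (indicator {1..L} l * (power_ldf \<beta> l / Z)) * h l \<partial>lborel)"
    unfolding length_measure_def normalizing_constant_power_ldf[OF \<beta>_pos less_imp_le[OF L_gt_1]]
      Z_def[symmetric]
    by (subst nn_integral_density) auto
  also have "\<dots> = (\<integral>\<^sup>+l. ennreal (1 / Z) * (h l * (ennreal (power_ldf \<beta> l) * indicator {1..L} l)) \<partial>lborel)"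
    by (intro nn_integral_cong) (auto simp: indicator_def scale mult_ac)
  also have "\<dots> = ennreal (1 / Z) * (\<integral>\<^sup>+l. h l * (ennreal (power_ldf \<beta> l) * indicator {1..L} l) \<partial>lborel)"
    by (rule nn_integral_cmult) measurable
  finally show ?thesis .
qed

lemma prob_space_length_measure: "prob_space (length_measure (power_ldf \<beta>) L)"
proof
  have "emeasure (length_measure (power_ldf \<beta>) L) (space (length_measure (power_ldf \<beta>) L)) =
      (\<integral>\<^sup>+l. 1 \<partial>length_measure (power_ldf \<beta>) L)"
    by simp
  also have "\<dots> = 1"
    using nn_integral_length_measure[of "\<lambda>_. 1"] nn_integral_power_ldf[of \<beta> L 1] \<beta>_pos L_gt_1 Z_pos
    by (simp add: Z_def[symmetric] ennreal_mult'[symmetric])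
  finally show "emeasure (length_measure (power_ldf \<beta>) L) (space (length_measure (power_ldf \<beta>) L)) = 1" .
qed

lemma prob_space_uniform: "prob_space (uniform_measure lborel {0..L})"
  using L_gt_1 by (intro prob_space_uniform_measure) auto

sublocale sample: prob_space sample
  unfolding sample_def
  by (rule prob_space_pair[OF prob_space_uniform prob_space_length_measure])

text \<open>Fubini and the two densities lead to Lebesgue integrals. The factor
  \<open>1 / (L * Z)\<close> stays outside because it cancels in
  \<open>mean_vacancy_window\<close>.\<close>

lemma nn_integral_sample:
  assumes [measurable]: "h \<in> borel_measurable (borel \<Otimes>\<^sub>M borel)"
  shows "(\<integral>\<^sup>+p. h p \<partial>sample) = ennreal (1 / (L * Z)) *
    (\<integral>\<^sup>+b. (\<integral>\<^sup>+l. h (b, l) * (ennreal (power_ldf \<beta> l) * indicator {1..L} l) \<partial>lborel) * indicator {0..L} b \<partial>lborel)"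
proof -
  interpret length: prob_space "length_measure (power_ldf \<beta>) L"
    by (rule prob_space_length_measure)
  have "h \<in> borel_measurable (uniform_measure lborel {0..L} \<Otimes>\<^sub>M length_measure (power_ldf \<beta>) L)"
    using assms sets_sample unfolding sample_def by (simp cong: measurable_cong_sets)
  then have "(\<integral>\<^sup>+p. h p \<partial>sample) =
      (\<integral>\<^sup>+b. (\<integral>\<^sup>+l. h (b, l) \<partial>length_measure (power_ldf \<beta>) L) \<partial>uniform_measure lborel {0..L})"
    unfolding sample_def by (rule length.nn_integral_fst[symmetric])
  also have "\<dots> = (\<integral>\<^sup>+b. ennreal (1 / Z) *
      (\<integral>\<^sup>+l. h (b, l) * (ennreal (power_ldf \<beta> l) * indicator {1..L} l) \<partial>lborel) \<partial>uniform_measure lborel {0..L})"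
    by (intro nn_integral_cong nn_integral_length_measure) measurable
  also have "\<dots> = (\<integral>\<^sup>+b. ennreal (1 / Z) *
      ((\<integral>\<^sup>+l. h (b, l) * (ennreal (power_ldf \<beta> l) * indicator {1..L} l) \<partial>lborel) * indicator {0..L} b) \<partial>lborel) / ennreal L"
    using L_gt_1 by (subst nn_integral_uniform_measure) (auto simp: mult.assoc)
  also have "\<dots> = ennreal (1 / Z) / ennreal L *
      (\<integral>\<^sup>+b. (\<integral>\<^sup>+l. h (b, l) * (ennreal (power_ldf \<beta> l) * indicator {1..L} l) \<partial>lborel) * indicator {0..L} b \<partial>lborel)"
    by (subst nn_integral_cmult) (auto simp: ennreal_times_divide[symmetric] divide_ennreal_def mult_ac)
  also have "ennreal (1 / Z) / ennreal L = ennreal (1 / (L * Z))"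
    using L_gt_1 Z_pos by (subst divide_ennreal) (auto simp: field_simps)
  finally show ?thesis .
qed

section \<open>Integrals over the segments that fit into \<open>[x, y]\<close>\<close>

definition admissible :: "real \<Rightarrow> real \<Rightarrow> real \<times> real \<Rightarrow> bool" where
  "admissible x y p \<longleftrightarrow> x \<le> fst p \<and> 1 \<le> snd p \<and> fst p + snd p \<le> y"

text \<open>The unnormalised weight of the fitting segments. For \<open>[x, y]\<close> inside
  \<open>[0, L]\<close> the bounds that the sample law puts on \<open>b\<close> and \<open>l\<close>
  all follow from \<open>admissible\<close>, so \<open>L\<close> no longer appears.\<close>

definition window_integral :: "real \<Rightarrow> real \<Rightarrow> (real \<times> real \<Rightarrow> ennreal) \<Rightarrow> ennreal" where
  "window_integral x y h = (\<integral>\<^sup>+b. \<integral>\<^sup>+l. (if admissible x y (b, l) then ennreal (power_ldf \<beta> l) * h (b, l) else 0) \<partial>lborel \<partial>lborel)"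

lemma pred_admissible [measurable]:
  assumes [measurable]: "f \<in> measurable M (borel \<Otimes>\<^sub>M borel)"
  shows "Measurable.pred M (\<lambda>z. admissible x y (f z))"
  unfolding admissible_def by measurable

lemma nn_integral_sample_fits:
  assumes [measurable]: "h \<in> borel_measurable (borel \<Otimes>\<^sub>M borel)" and xy: "0 \<le> x" "y \<le> L"
  shows "(\<integral>\<^sup>+p. (if fits x y p then h p else 0) \<partial>sample) = ennreal (1 / (L * Z)) * window_integral x y h"
proof -
  have "(\<integral>\<^sup>+p. (if fits x y p then h p else 0) \<partial>sample) = ennreal (1 / (L * Z)) *
    (\<integral>\<^sup>+b. (\<integral>\<^sup>+l. (if fits x y (b, l) then h (b, l) else 0) * (ennreal (power_ldf \<beta> l) * indicator {1..L} l) \<partial>lborel) * indicator {0..L} b \<partial>lborel)"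
    by (rule nn_integral_sample) measurable
  also have "(\<integral>\<^sup>+b. (\<integral>\<^sup>+l. (if fits x y (b, l) then h (b, l) else 0) * (ennreal (power_ldf \<beta> l) * indicator {1..L} l) \<partial>lborel) * indicator {0..L} b \<partial>lborel)
    = (\<integral>\<^sup>+b. \<integral>\<^sup>+l. (if fits x y (b, l) then h (b, l) else 0) * (ennreal (power_ldf \<beta> l) * indicator {1..L} l) * indicator {0..L} b \<partial>lborel \<partial>lborel)"
    by (intro nn_integral_cong nn_integral_multc[symmetric]) measurable
  also have "\<dots> = window_integral x y h"
    unfolding window_integral_def
    by (intro nn_integral_cong) (use xy in \<open>auto simp: fits_def admissible_def indicator_def mult_ac\<close>)
  finally show ?thesis .
qed

text \<open>Here \<open>u\<close> is the length of one remainder. It leaves room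
  \<open>s - u\<close> for the excess of the segment length over 1, and the density integrates over
  this excess to \<open>(s - u) powr \<beta> / \<beta>\<close>.\<close>

definition kernel_integral :: "real \<Rightarrow> (real \<Rightarrow> ennreal) \<Rightarrow> ennreal" where
  "kernel_integral s \<phi> = (\<integral>\<^sup>+u. \<phi> u * (ennreal ((s - u) powr \<beta>) * indicator {0..s} u) \<partial>lborel)"

text \<open>Integrate out the length first: for fixed \<open>b\<close> it runs from 1 to
  \<open>y - b\<close>, and no length is left once \<open>b\<close> exceeds \<open>y - 1\<close>.
  Then shift \<open>b\<close> by \<open>x\<close>.\<close>

lemma window_integral_left:
  assumes [measurable]: "\<phi> \<in> borel_measurable borel"
  shows "window_integral x y (\<lambda>p. \<phi> (fst p - x)) = ennreal (1 / \<beta>) * kernel_integral (y - x - 1) \<phi>"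
proof -
  have inner: "(\<integral>\<^sup>+l. (if admissible x y (b, l) then ennreal (power_ldf \<beta> l) * \<phi> (b - x) else 0) \<partial>lborel) =
      ennreal (1 / \<beta>) * (\<phi> (b - x) * (ennreal ((y - b - 1) powr \<beta>) * indicator {x..y - 1} b))" for b
  proof -
    have "(\<integral>\<^sup>+l. (if admissible x y (b, l) then ennreal (power_ldf \<beta> l) * \<phi> (b - x) else 0) \<partial>lborel) =
        (\<integral>\<^sup>+l. \<phi> (b - x) * indicator {x..} b * (ennreal (power_ldf \<beta> l) * indicator {1..y - b} l) \<partial>lborel)"
      by (intro nn_integral_cong) (auto simp: admissible_def indicator_def mult_ac)
    also have "\<dots> = \<phi> (b - x) * indicator {x..} b * (\<integral>\<^sup>+l. ennreal (power_ldf \<beta> l) * indicator {1..y - b} l \<partial>lborel)"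
      by (rule nn_integral_cmult) measurable
    also have "\<dots> = ennreal (1 / \<beta>) * (\<phi> (b - x) * (ennreal ((y - b - 1) powr \<beta>) * indicator {x..y - 1} b))"
    proof (cases "b \<le> y - 1")
      case True
      then have "(\<integral>\<^sup>+l. ennreal (power_ldf \<beta> l) * indicator {1..y - b} l \<partial>lborel) =
          ennreal (1 / \<beta>) * ennreal ((y - b - 1) powr \<beta>)"
        using \<beta>_pos by (subst nn_integral_power_ldf) (auto simp: ennreal_mult'[symmetric])
      with True show ?thesis
        by (simp add: indicator_def mult_ac)
    qed simp
    finally show ?thesis .
  qed
  have "window_integral x y (\<lambda>p. \<phi> (fst p - x)) =
      (\<integral>\<^sup>+b. ennreal (1 / \<beta>) * (\<phi> (b - x) * (ennreal ((y - b - 1) powr \<beta>) * indicator {x..y - 1} b)) \<partial>lborel)"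
    by (simp only: window_integral_def fst_conv inner)
  also have "\<dots> = ennreal (1 / \<beta>) * (\<integral>\<^sup>+b. \<phi> (b - x) * (ennreal ((y - b - 1) powr \<beta>) * indicator {x..y - 1} b) \<partial>lborel)"
    by (rule nn_integral_cmult) measurable
  also have "(\<integral>\<^sup>+b. \<phi> (b - x) * (ennreal ((y - b - 1) powr \<beta>) * indicator {x..y - 1} b) \<partial>lborel) =
      kernel_integral (y - x - 1) \<phi>"
    unfolding kernel_integral_def
    by (subst nn_integral_real_affine[where t = x and c = 1])
      (auto intro!: nn_integral_cong simp: indicator_def algebra_simps)
  finally show ?thesis .
qed

text \<open>At fixed length \<open>l\<close>, sending \<open>b\<close> to
  \<open>x + y - l - b\<close> exchanges the two remainders and preserves admissibility. Fubini
  brings the integral over \<open>b\<close> inside for this.\<close>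

lemma window_integral_reflect:
  assumes [measurable]: "\<phi> \<in> borel_measurable borel"
  shows "window_integral x y (\<lambda>p. \<phi> (y - (fst p + snd p))) = window_integral x y (\<lambda>p. \<phi> (fst p - x))"
proof -
  have "window_integral x y (\<lambda>p. \<phi> (y - (fst p + snd p))) =
      (\<integral>\<^sup>+l. \<integral>\<^sup>+b. (if admissible x y (b, l) then ennreal (power_ldf \<beta> l) * \<phi> (y - (b + l)) else 0) \<partial>lborel \<partial>lborel)"
    unfolding window_integral_def fst_conv snd_conv by (rule lborel_pair.Fubini') measurable
  also have "\<dots> = (\<integral>\<^sup>+l. \<integral>\<^sup>+b. (if admissible x y (b, l) then ennreal (power_ldf \<beta> l) * \<phi> (b - x) else 0) \<partial>lborel \<partial>lborel)"
  proof (rule nn_integral_cong)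
    fix l :: real
    show "(\<integral>\<^sup>+b. (if admissible x y (b, l) then ennreal (power_ldf \<beta> l) * \<phi> (y - (b + l)) else 0) \<partial>lborel) =
      (\<integral>\<^sup>+b. (if admissible x y (b, l) then ennreal (power_ldf \<beta> l) * \<phi> (b - x) else 0) \<partial>lborel)"
      by (subst nn_integral_real_affine[where t = "x + y - l" and c = "-1"])
        (auto intro!: nn_integral_cong simp: admissible_def algebra_simps)
  qed
  also have "\<dots> = window_integral x y (\<lambda>p. \<phi> (fst p - x))"
    unfolding window_integral_def fst_conv by (rule lborel_pair.Fubini'[symmetric]) measurable
  finally show ?thesis .
qed

lemma window_integral_add:
  assumes [measurable]: "f \<in> borel_measurable (borel \<Otimes>\<^sub>M borel)" "g \<in> borel_measurable (borel \<Otimes>\<^sub>M borel)"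
  shows "window_integral x y (\<lambda>p. f p + g p) = window_integral x y f + window_integral x y g"
proof -
  let ?w = "\<lambda>h b l. if admissible x y (b, l) then ennreal (power_ldf \<beta> l) * h (b, l) else (0::ennreal)"
  have "?w (\<lambda>p. f p + g p) b l = ?w f b l + ?w g b l" for b l
    by (simp add: distrib_left)
  then have "window_integral x y (\<lambda>p. f p + g p) = (\<integral>\<^sup>+b. \<integral>\<^sup>+l. ?w f b l + ?w g b l \<partial>lborel \<partial>lborel)"
    by (simp only: window_integral_def)
  also have "\<dots> = (\<integral>\<^sup>+b. (\<integral>\<^sup>+l. ?w f b l \<partial>lborel) + (\<integral>\<^sup>+l. ?w g b l \<partial>lborel) \<partial>lborel)"
    by (intro nn_integral_cong nn_integral_add) measurable
  also have "\<dots> = window_integral x y f + window_integral x y g"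
    unfolding window_integral_def by (rule nn_integral_add) measurable
  finally show ?thesis .
qed

text \<open>Both remainders contribute equally, which is the source of the factor 2 in the
  recursion.\<close>

lemma window_integral_sum:
  assumes [measurable]: "\<phi> \<in> borel_measurable borel"
  shows "window_integral x y (\<lambda>p. \<phi> (fst p - x) + \<phi> (y - (fst p + snd p))) =
    ennreal (2 / \<beta>) * kernel_integral (y - x - 1) \<phi>"
proof -
  have "window_integral x y (\<lambda>p. \<phi> (fst p - x) + \<phi> (y - (fst p + snd p))) =
     window_integral x y (\<lambda>p. \<phi> (fst p - x)) + window_integral x y (\<lambda>p. \<phi> (y - (fst p + snd p)))"
    by (rule window_integral_add) measurable
  also have "\<dots> = (ennreal (1 / \<beta>) + ennreal (1 / \<beta>)) * kernel_integral (y - x - 1) \<phi>"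
    by (simp add: window_integral_reflect window_integral_left distrib_right)
  also have "ennreal (1 / \<beta>) + ennreal (1 / \<beta>) = ennreal (2 / \<beta>)"
    using \<beta>_pos by (subst ennreal_plus[symmetric]) auto
  finally show ?thesis .
qed

section \<open>The law of the sample sequence and the recursion for the mean\<close>

definition law :: "(nat \<Rightarrow> real \<times> real) measure" where
  "law = rsa_measure (power_ldf \<beta>) L"

lemma law_eq: "law = Pi\<^sub>M UNIV (\<lambda>_. sample)"
  by (simp add: law_def rsa_measure_def sample_def)

lemma sets_law: "sets law = sets samples"
  unfolding law_eq by (intro sets_PiM_cong refl sets_sample)

sublocale seq: sequence_space sample
  by unfold_locales

sublocale law: prob_space law
  unfolding law_eq by (rule prob_space_PiM) (rule sample.prob_space_axioms)

text \<open>Prepending an independent sample to an i.i.d. sequence does not change its law; Fubini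
  then conditions on the first sample.\<close>

lemma nn_integral_law:
  assumes "f \<in> borel_measurable samples"
  shows "(\<integral>\<^sup>+\<omega>. f \<omega> \<partial>law) = (\<integral>\<^sup>+p. \<integral>\<^sup>+\<omega>. f (case_nat p \<omega>) \<partial>law \<partial>sample)"
proof -
  have f [measurable]: "f \<in> borel_measurable (Pi\<^sub>M UNIV (\<lambda>_. sample))"
    using assms sets_law unfolding law_eq by (simp cong: measurable_cong_sets)
  have "(\<integral>\<^sup>+\<omega>. f \<omega> \<partial>law) = (\<integral>\<^sup>+\<omega>. f \<omega> \<partial>distr (sample \<Otimes>\<^sub>M law) law (\<lambda>(s, \<omega>). case_nat s \<omega>))"
    unfolding law_eq seq.PiM_iter ..
  also have "\<dots> = (\<integral>\<^sup>+z. f (case_nat (fst z) (snd z)) \<partial>(sample \<Otimes>\<^sub>M law))"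
    unfolding law_eq by (subst nn_integral_distr) (auto simp: case_prod_beta)
  also have "\<dots> = (\<integral>\<^sup>+p. \<integral>\<^sup>+\<omega>. f (case_nat p \<omega>) \<partial>law \<partial>sample)"
    by (subst law.nn_integral_fst[symmetric]) (unfold law_eq, measurable)
  finally show ?thesis .
qed

text \<open>Taken in the extended nonnegative reals, where Fubini and additivity ask for
  measurability alone.\<close>

definition mean_vacancy :: "real \<Rightarrow> real \<Rightarrow> ennreal" where
  "mean_vacancy x y = (\<integral>\<^sup>+\<omega>. ennreal (final_vacancy x y \<omega>) \<partial>law)"

lemma measurable_mean_vacancy [measurable]:
  assumes [measurable]: "f \<in> borel_measurable M" "g \<in> borel_measurable M"
  shows "(\<lambda>z. mean_vacancy (f z) (g z)) \<in> borel_measurable M"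
proof -
  have [measurable]: "(\<lambda>z. snd z) \<in> measurable (M \<Otimes>\<^sub>M law) samples"
    using measurable_snd[of M law] by (simp add: sets_law cong: measurable_cong_sets)
  show ?thesis
    unfolding mean_vacancy_def
    by (rule law.borel_measurable_nn_integral) (simp add: case_prod_beta)
qed

lemma mean_vacancy_le: "x \<le> y \<Longrightarrow> mean_vacancy x y \<le> ennreal (y - x)"
  unfolding mean_vacancy_def
  by (rule order_trans[OF nn_integral_mono[where v = "\<lambda>_. ennreal (y - x)"]])
    (auto simp: final_vacancy_le ennreal_leI law.emeasure_space_1)

text \<open>In \<open>case_nat p \<omega>\<close> the first sample is \<open>p\<close> and the
  shifted samples are \<open>\<omega>\<close>, again distributed by \<open>law\<close>, so
  \<open>final_vacancy_rec\<close> integrates term by term.\<close>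

lemma mean_vacancy_first_sample:
  assumes "x \<le> y"
  shows "mean_vacancy x y =
    (\<integral>\<^sup>+p. (if fits x y p then mean_vacancy x (fst p) + mean_vacancy (fst p + snd p) y
       else mean_vacancy x y) \<partial>sample)"
proof -
  have meas: "(\<lambda>\<omega>. ennreal (final_vacancy x y \<omega>)) \<in> borel_measurable law" for x y
    using sets_law by (simp cong: measurable_cong_sets)
  have "mean_vacancy x y = (\<integral>\<^sup>+p. \<integral>\<^sup>+\<omega>. ennreal (final_vacancy x y (case_nat p \<omega>)) \<partial>law \<partial>sample)"
    unfolding mean_vacancy_def by (rule nn_integral_law) measurable
  also have "\<dots> = (\<integral>\<^sup>+p. (if fits x y p then mean_vacancy x (fst p) + mean_vacancy (fst p + snd p) y
       else mean_vacancy x y) \<partial>sample)"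
  proof (rule nn_integral_cong)
    fix p
    have "(\<integral>\<^sup>+\<omega>. ennreal (final_vacancy x y (case_nat p \<omega>)) \<partial>law) =
        (\<integral>\<^sup>+\<omega>. (if fits x y p then ennreal (final_vacancy x (fst p) \<omega>) + ennreal (final_vacancy (fst p + snd p) y \<omega>)
          else ennreal (final_vacancy x y \<omega>)) \<partial>law)"
      by (intro nn_integral_cong, subst final_vacancy_rec[OF assms])
        (auto simp: fits_def final_vacancy_nonneg)
    then show "(\<integral>\<^sup>+\<omega>. ennreal (final_vacancy x y (case_nat p \<omega>)) \<partial>law) =
        (if fits x y p then mean_vacancy x (fst p) + mean_vacancy (fst p + snd p) y else mean_vacancy x y)"
      by (simp add: mean_vacancy_def nn_integral_add meas)
  qed
  finally show ?thesis .
qed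

text \<open>A rejected first sample restarts the process and contributes the same mean, weighted
  with the rejection probability; cancelling this leaves the accepted samples.\<close>

lemma mean_vacancy_times_fits:
  assumes "x \<le> y"
  shows "mean_vacancy x y * (\<integral>\<^sup>+p. (if fits x y p then 1 else 0) \<partial>sample) =
    (\<integral>\<^sup>+p. (if fits x y p then mean_vacancy x (fst p) + mean_vacancy (fst p + snd p) y else 0) \<partial>sample)"
    (is "_ * ?A = ?I")
proof -
  let ?m = "mean_vacancy x y" and ?B = "\<integral>\<^sup>+p. (if fits x y p then 0 else 1) \<partial>sample"
  have ident [measurable]: "(\<lambda>p. p) \<in> measurable sample (borel \<Otimes>\<^sub>M borel)"
    using measurable_ident_sets[OF sets_sample] .
  have [measurable]: "fst \<in> borel_measurable sample" "snd \<in> borel_measurable sample"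
    using measurable_compose[OF ident measurable_fst] measurable_compose[OF ident measurable_snd]
    by simp_all
  have "?A + ?B = (\<integral>\<^sup>+p. (if fits x y p then 1 else 0) + (if fits x y p then 0 else 1) \<partial>sample)"
    by (rule nn_integral_add[symmetric]) measurable
  also have "\<dots> = (\<integral>\<^sup>+p. 1 \<partial>sample)"
    by (intro nn_integral_cong) simp
  finally have "?m * (?A + ?B) = ?m"
    by (simp add: sample.emeasure_space_1)
  also have "?m = ?I + (\<integral>\<^sup>+p. ?m * (if fits x y p then 0 else 1) \<partial>sample)"
    by (subst mean_vacancy_first_sample[OF assms], subst nn_integral_add[symmetric])
      (auto intro!: nn_integral_cong)
  also have "(\<integral>\<^sup>+p. ?m * (if fits x y p then 0 else 1) \<partial>sample) = ?m * ?B"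
    by (rule nn_integral_cmult) measurable
  finally have "?m * ?B + ?m * ?A = ?m * ?B + ?I"
    by (simp add: distrib_left add.commute)
  \<comment> \<open>Cancellation in \<open>ennreal\<close> requires a finite term; the mean is at
    most the length \<open>y - x\<close>.\<close>
  moreover have "?m * ?B < \<top>"
  proof -
    have "?m * ?B \<le> ennreal (y - x) * (\<integral>\<^sup>+p. 1 \<partial>sample)"
      by (intro mult_mono mean_vacancy_le assms nn_integral_mono) auto
    also have "\<dots> < \<top>"
      by (simp add: sample.emeasure_space_1)
    finally show ?thesis .
  qed
  ultimately show ?thesis
    unfolding ennreal_add_left_cancel by auto
qed

lemma mean_vacancy_window:
  assumes "0 \<le> x" "x \<le> y" "y \<le> L"
  shows "mean_vacancy x y * (ennreal (1 / \<beta>) * kernel_integral (y - x - 1) (\<lambda>_. 1)) =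
    window_integral x y (\<lambda>p. mean_vacancy x (fst p) + mean_vacancy (fst p + snd p) y)"
proof -
  have 1: "(\<integral>\<^sup>+p. (if fits x y p then 1 else 0) \<partial>sample) =
      ennreal (1 / (L * Z)) * (ennreal (1 / \<beta>) * kernel_integral (y - x - 1) (\<lambda>_. 1))"
    using nn_integral_sample_fits[of "\<lambda>_. 1"] window_integral_left[of "\<lambda>_. 1" x y] assms by simp
  have 2: "(\<integral>\<^sup>+p. (if fits x y p then mean_vacancy x (fst p) + mean_vacancy (fst p + snd p) y else 0) \<partial>sample) =
      ennreal (1 / (L * Z)) * window_integral x y (\<lambda>p. mean_vacancy x (fst p) + mean_vacancy (fst p + snd p) y)"
    using assms by (intro nn_integral_sample_fits) auto
  have c: "0 < 1 / (L * Z)"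
    using L_gt_1 Z_pos by simp
  from mean_vacancy_times_fits[OF \<open>x \<le> y\<close>] show ?thesis
    unfolding 1 2 using c L_gt_1 Z_pos
    by (auto simp: mult.left_commute[of "mean_vacancy x y"] ennreal_mult_cancel_left)
qed

text \<open>The mean is indexed by end points, but a bound by length alone makes the window integral
  computable. Each remainder is shorter by at least 1, so the bound is assumed only up to
  \<open>y - x - 1\<close>, as an induction supplies it.\<close>

lemma mean_vacancy_upper:
  assumes "0 \<le> x" "x \<le> y" "y \<le> L" and [measurable]: "\<phi> \<in> borel_measurable borel"
    and le: "\<And>u v. 0 \<le> u \<Longrightarrow> u \<le> v \<Longrightarrow> v \<le> L \<Longrightarrow> v - u \<le> y - x - 1 \<Longrightarrow> mean_vacancy u v \<le> \<phi> (v - u)"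
  shows "mean_vacancy x y * kernel_integral (y - x - 1) (\<lambda>_. 1) \<le> 2 * kernel_integral (y - x - 1) \<phi>"
proof -
  have "mean_vacancy x y * (ennreal (1 / \<beta>) * kernel_integral (y - x - 1) (\<lambda>_. 1)) \<le>
      window_integral x y (\<lambda>p. \<phi> (fst p - x) + \<phi> (y - (fst p + snd p)))"
    unfolding mean_vacancy_window[OF assms(1-3)] window_integral_def
    by (intro nn_integral_mono)
      (use assms(1-3) in \<open>auto simp: admissible_def intro!: mult_left_mono add_mono le\<close>)
  also have "\<dots> = ennreal (1 / \<beta>) * (2 * kernel_integral (y - x - 1) \<phi>)"
  proof -
    have "ennreal (2 / \<beta>) = ennreal (1 / \<beta>) * 2"
      using \<beta>_pos by (simp flip: ennreal_numeral add: ennreal_mult'[symmetric])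
    then show ?thesis
      by (simp add: window_integral_sum mult_ac)
  qed
  finally show ?thesis
    using \<beta>_pos by (simp add: mult.left_commute[of "mean_vacancy x y"] ennreal_mult_le_mult_iff)
qed

lemma mean_vacancy_lower:
  assumes "0 \<le> x" "x \<le> y" "y \<le> L" and [measurable]: "\<phi> \<in> borel_measurable borel"
    and le: "\<And>u v. 0 \<le> u \<Longrightarrow> u \<le> v \<Longrightarrow> v \<le> L \<Longrightarrow> v - u \<le> y - x - 1 \<Longrightarrow> \<phi> (v - u) \<le> mean_vacancy u v"
  shows "2 * kernel_integral (y - x - 1) \<phi> \<le> mean_vacancy x y * kernel_integral (y - x - 1) (\<lambda>_. 1)"
proof -
  have "ennreal (1 / \<beta>) * (2 * kernel_integral (y - x - 1) \<phi>) =
      window_integral x y (\<lambda>p. \<phi> (fst p - x) + \<phi> (y - (fst p + snd p)))"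
  proof -
    have "ennreal (2 / \<beta>) = ennreal (1 / \<beta>) * 2"
      using \<beta>_pos by (simp flip: ennreal_numeral add: ennreal_mult'[symmetric])
    then show ?thesis
      by (simp add: window_integral_sum mult_ac)
  qed
  also have "\<dots> \<le> mean_vacancy x y * (ennreal (1 / \<beta>) * kernel_integral (y - x - 1) (\<lambda>_. 1))"
    unfolding mean_vacancy_window[OF assms(1-3)] window_integral_def
    by (intro nn_integral_mono)
      (use assms(1-3) in \<open>auto simp: admissible_def intro!: mult_left_mono add_mono le\<close>)
  finally show ?thesis
    using \<beta>_pos by (simp add: mult.left_commute[of "mean_vacancy x y"] ennreal_mult_le_mult_iff)
qed

text \<open>The length density vanishes below 1, and countably many null sets are discarded at once.
  This is what makes intervals shorter than 1 final.\<close>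

lemma AE_law_length_ge_1: "AE \<omega> in law. \<forall>n. 1 \<le> snd (\<omega> n)"
proof -
  interpret length: prob_space "length_measure (power_ldf \<beta>) L"
    by (rule prob_space_length_measure)
  interpret uniform: prob_space "uniform_measure lborel {0..L}"
    by (rule prob_space_uniform)
  have "AE l in length_measure (power_ldf \<beta>) L. 1 \<le> l"
    unfolding length_measure_def by (subst AE_density) (auto simp: indicator_def)
  interpret pair_sigma_finite "uniform_measure lborel {0..L}" "length_measure (power_ldf \<beta>) L" ..
  have "{p \<in> space sample. 1 \<le> snd p} \<in> sets sample"
    unfolding sets_sample sets_eq_imp_space_eq[OF sets_sample] by measurable
  then have "AE p in sample. 1 \<le> snd p"
    unfolding sample_def using \<open>AE l in length_measure (power_ldf \<beta>) L. 1 \<le> l\<close>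
    by (intro AE_pair_measure) auto
  then have "AE \<omega> in law. 1 \<le> snd (\<omega> n)" for n
    unfolding law_eq by (intro AE_PiM_component sample.prob_space_axioms) auto
  then show ?thesis
    by (simp add: AE_all_countable)
qed

lemma mean_vacancy_short:
  assumes "x \<le> y" "y - x < 1"
  shows "mean_vacancy x y = ennreal (y - x)"
proof -
  have "AE \<omega> in law. ennreal (final_vacancy x y \<omega>) = ennreal (y - x)"
    using AE_law_length_ge_1 by eventually_elim (simp add: final_vacancy_short assms)
  from nn_integral_cong_AE[OF this] show ?thesis
    by (simp add: mean_vacancy_def law.emeasure_space_1)
qed

text \<open>Passes from the Bochner integral of the definition to \<open>ennreal\<close>; nothing is
  lost, since the mean is at most \<open>L\<close>.\<close>

lemma ennreal_expected_space: "ennreal (expected_space (power_ldf \<beta>) L) = mean_vacancy 0 L"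
proof -
  have "saturation_space L = final_vacancy 0 L"
    using L_gt_1 by (intro ext saturation_space_eq) simp
  then have "expected_space (power_ldf \<beta>) L = (\<integral>\<omega>. final_vacancy 0 L \<omega> \<partial>law)"
    using L_gt_1 by (simp add: expected_space_def law_def)
  also have "\<dots> = enn2real (mean_vacancy 0 L)"
    unfolding mean_vacancy_def using L_gt_1 sets_law
    by (intro integral_eq_nn_integral) (auto simp: final_vacancy_nonneg cong: measurable_cong_sets)
  finally show ?thesis
    using mean_vacancy_le[of 0 L] L_gt_1
    by (metis ennreal_enn2real ennreal_less_top le_less_trans less_imp_le less_trans zero_less_one)
qed

subsection \<open>Comparison with powers\<close>

text \<open>Scaling \<open>u\<close> by \<open>s\<close> splits off
  \<open>s powr (\<theta> + \<beta>)\<close> from the integrand and one more \<open>s\<close> from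
  the differential, leaving the Beta integral on \<open>[0, 1]\<close>.\<close>

lemma kernel_integral_powr:
  assumes "0 < s" "0 \<le> \<theta>"
  shows "kernel_integral s (\<lambda>u. ennreal (u powr \<theta>)) = ennreal (s powr (\<theta> + \<beta> + 1) * Beta (\<beta> + 1) (\<theta> + 1))"
proof -
  have integrand: "ennreal ((0 + s * u) powr \<theta>) * (ennreal ((s - (0 + s * u)) powr \<beta>) * indicator {0..s} (0 + s * u)) =
      ennreal (s powr (\<theta> + \<beta>)) * (ennreal (u powr \<theta> * (1 - u) powr \<beta>) * indicator {0..1} u)" for u
  proof (cases "u \<in> {0..1}")
    case True
    have "s - s * u = s * (1 - u)"
      by (simp add: algebra_simps)
    with True assms show ?thesis
      by (simp add: powr_mult powr_add ennreal_mult'[symmetric] mult_ac mult_left_le)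
  next
    case False
    with assms have "s * u \<notin> {0..s}"
      by (auto simp: zero_le_mult_iff mult_le_cancel_left1)
    with False show ?thesis
      by simp
  qed
  have Beta: "(\<integral>\<^sup>+u. ennreal (u powr \<theta> * (1 - u) powr \<beta>) * indicator {0..1} u \<partial>lborel) = ennreal (Beta (\<theta> + 1) (\<beta> + 1))"
    using has_integral_Beta_real[of "\<theta> + 1" "\<beta> + 1"] assms \<beta>_pos
    by (intro nn_integral_has_integral_lebesgue') auto
  have "kernel_integral s (\<lambda>u. ennreal (u powr \<theta>)) =
      ennreal s * (\<integral>\<^sup>+u. ennreal (s powr (\<theta> + \<beta>)) * (ennreal (u powr \<theta> * (1 - u) powr \<beta>) * indicator {0..1} u) \<partial>lborel)"
    unfolding kernel_integral_def using assms
    by (subst nn_integral_real_affine[where t = 0 and c = s]) (simp_all only: integrand, auto)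
  also have "\<dots> = ennreal s * (ennreal (s powr (\<theta> + \<beta>)) * ennreal (Beta (\<theta> + 1) (\<beta> + 1)))"
    by (subst nn_integral_cmult) (auto simp: Beta)
  also have "\<dots> = ennreal (s powr (\<theta> + \<beta> + 1) * Beta (\<theta> + 1) (\<beta> + 1))"
    using assms by (simp add: ennreal_mult'[symmetric]) (simp add: powr_add mult_ac)
  finally show ?thesis
    by (simp add: Beta_commute)
qed

lemma kernel_integral_one:
  assumes "0 \<le> s"
  shows "kernel_integral s (\<lambda>_. 1) = ennreal (s powr (\<beta> + 1) / (\<beta> + 1))"
proof -
  have "kernel_integral s (\<lambda>_. 1) = (\<integral>\<^sup>+u. ennreal (u powr \<beta>) * indicator {0..s} u \<partial>lborel)"
    unfolding kernel_integral_def
    by (subst nn_integral_real_affine[where t = s and c = "-1"])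
      (auto intro!: nn_integral_cong simp: indicator_def)
  also have "\<dots> = ennreal (s powr (\<beta> + 1) / (\<beta> + 1))"
    by (rule nn_integral_has_integral_lebesgue'[OF _ has_integral_powr_from_0]) (use assms \<beta>_pos in auto)
  finally show ?thesis .
qed

text \<open>The assumption on the Beta value says that \<open>u powr \<theta>\<close>, inserted on
  the right of the recursion, returns at most \<open>s powr \<theta>\<close> with
  \<open>s = y - x - 1\<close>, slightly better than required.\<close>

lemma mean_vacancy_le_powr:
  assumes \<theta>: "0 < \<theta>" "\<theta> \<le> 1" "2 * (\<beta> + 1) * Beta (\<beta> + 1) (\<theta> + 1) \<le> 1"
    and "0 \<le> x" "x \<le> y" "y \<le> L"
  shows "mean_vacancy x y \<le> ennreal ((y - x) powr \<theta>)"
proof -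
  have "mean_vacancy x y \<le> ennreal ((y - x) powr \<theta>)"
    if "y - x \<le> real n" "0 \<le> x" "x \<le> y" "y \<le> L" for n x y
    using that
  proof (induction n arbitrary: x y)
    case 0
    then show ?case
      using mean_vacancy_le[of x y] by simp
  next
    case (Suc n)
    show ?case
    proof (cases "y - x \<le> 1")
      case True
      \<comment> \<open>Up to length 1 the trivial bound by the length suffices; this is where
        \<open>\<theta> \<le> 1\<close> enters.\<close>
      then have "y - x \<le> (y - x) powr \<theta>"
        using Suc.prems \<theta> powr_mono'[of \<theta> 1 "y - x"] by simp
      then show ?thesis
        using mean_vacancy_le[OF \<open>x \<le> y\<close>] ennreal_leI order_trans by blast
    next
      case False
      define s where "s = y - x - 1"
      have s: "0 < s" "s \<le> n"
        using False Suc.prems by (auto simp: s_def)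
      have "mean_vacancy x y * kernel_integral s (\<lambda>_. 1) \<le> 2 * kernel_integral s (\<lambda>u. ennreal (u powr \<theta>))"
        unfolding s_def by (rule mean_vacancy_upper) (use Suc s in \<open>auto simp: s_def\<close>)
      also have "\<dots> = ennreal (2 * (s powr (\<theta> + \<beta> + 1) * Beta (\<beta> + 1) (\<theta> + 1)))"
        using s \<theta> by (simp add: kernel_integral_powr ennreal_mult')
      also have "\<dots> \<le> ennreal (s powr \<theta> * (s powr (\<beta> + 1) / (\<beta> + 1)))"
      proof (rule ennreal_leI)
        have "2 * Beta (\<beta> + 1) (\<theta> + 1) \<le> 1 / (\<beta> + 1)"
          using \<theta> \<beta>_pos by (simp add: field_simps)
        from mult_left_mono[OF this, of "s powr (\<theta> + \<beta> + 1)"]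
        show "2 * (s powr (\<theta> + \<beta> + 1) * Beta (\<beta> + 1) (\<theta> + 1)) \<le> s powr \<theta> * (s powr (\<beta> + 1) / (\<beta> + 1))"
          by (simp add: powr_add mult_ac)
      qed
      finally have "ennreal (s powr (\<beta> + 1) / (\<beta> + 1)) * mean_vacancy x y \<le>
          ennreal (s powr (\<beta> + 1) / (\<beta> + 1)) * ennreal (s powr \<theta>)"
        using s \<beta>_pos by (simp add: kernel_integral_one ennreal_mult'[symmetric] mult_ac)
      then have "mean_vacancy x y \<le> ennreal (s powr \<theta>)"
        using s \<beta>_pos by (subst (asm) ennreal_mult_le_mult_iff) auto
      also have "\<dots> \<le> ennreal ((y - x) powr \<theta>)"
        using s \<theta> by (intro ennreal_leI powr_mono2) (auto simp: s_def)
      finally show ?thesis .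
    qed
  qed
  from this[of y x "nat \<lceil>y - x\<rceil>"] show ?thesis
    using assms real_nat_ceiling_ge by blast
qed

text \<open>The lower comparison concerns lengths from 2 on, so the trial function is cut off there.
  The loss is an integral over \<open>[0, 2]\<close> bounded by
  \<open>c * (2 powr \<theta> * s powr \<beta>)\<close> pointwise, of lower order in
  \<open>s\<close> than the main term.\<close>

lemma kernel_integral_truncated_powr:
  assumes "0 < s" "0 \<le> \<theta>" "0 \<le> c"
  shows "ennreal (c * (s powr (\<theta> + \<beta> + 1) * Beta (\<beta> + 1) (\<theta> + 1))) \<le>
    kernel_integral s (\<lambda>u. ennreal (if 2 \<le> u then c * u powr \<theta> else 0)) + ennreal (c * (2 powr (\<theta> + 1) * s powr \<beta>))"
proof -
  let ?\<phi> = "\<lambda>u. ennreal (if 2 \<le> u then c * u powr \<theta> else 0)" and ?k = "\<lambda>u. ennreal ((s - u) powr \<beta>) * indicator {0..s} u"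
  have "ennreal (c * (s powr (\<theta> + \<beta> + 1) * Beta (\<beta> + 1) (\<theta> + 1))) = ennreal c * kernel_integral s (\<lambda>u. ennreal (u powr \<theta>))"
    using assms by (simp add: kernel_integral_powr ennreal_mult')
  also have "\<dots> = (\<integral>\<^sup>+u. ennreal c * (ennreal (u powr \<theta>) * ?k u) \<partial>lborel)"
    unfolding kernel_integral_def by (rule nn_integral_cmult[symmetric]) measurable
  also have "\<dots> \<le> (\<integral>\<^sup>+u. ?\<phi> u * ?k u + ennreal (c * (2 powr \<theta> * s powr \<beta>)) * indicator {0..2} u \<partial>lborel)"
  proof (rule nn_integral_mono)
    fix u
    show "ennreal c * (ennreal (u powr \<theta>) * ?k u) \<le> ?\<phi> u * ?k u + ennreal (c * (2 powr \<theta> * s powr \<beta>)) * indicator {0..2} u"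
    proof (cases "2 \<le> u \<or> u \<notin> {0..s}")
      case True
      then show ?thesis
        using assms by (auto simp: ennreal_mult' mult_ac intro: add_increasing2)
    next
      case False
      then have "u powr \<theta> * (s - u) powr \<beta> \<le> 2 powr \<theta> * s powr \<beta>"
        using assms \<beta>_pos by (intro mult_mono powr_mono2) auto
      from mult_left_mono[OF this \<open>0 \<le> c\<close>] have "ennreal (c * (u powr \<theta> * (s - u) powr \<beta>)) \<le> ennreal (c * (2 powr \<theta> * s powr \<beta>))"
        by (rule ennreal_leI)
      with False assms show ?thesis
        by (simp add: ennreal_mult')
    qed
  qed
  also have "\<dots> = kernel_integral s ?\<phi> + (\<integral>\<^sup>+u. ennreal (c * (2 powr \<theta> * s powr \<beta>)) * indicator {0..2::real} u \<partial>lborel)"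
    unfolding kernel_integral_def by (rule nn_integral_add) measurable
  also have "(\<integral>\<^sup>+u. ennreal (c * (2 powr \<theta> * s powr \<beta>)) * indicator {0..2::real} u \<partial>lborel) = ennreal (c * (2 powr \<theta> * s powr \<beta>)) * ennreal 2"
    by (subst nn_integral_cmult_indicator) auto
  also have "\<dots> = ennreal (c * (2 powr (\<theta> + 1) * s powr \<beta>))"
    using assms by (subst ennreal_mult[symmetric]) (auto simp: powr_add mult_ac)
  finally show ?thesis .
qed

text \<open>Remainders of length at most \<open>1 / 2\<close> almost surely stay empty and occur
  with positive weight. The resulting bound is uniform on \<open>[2, D]\<close> and starts the lower
  induction.\<close>

lemma mean_vacancy_ge_const:
  assumes "0 \<le> x" "y \<le> L" "2 \<le> y - x" "y - x \<le> D"
  shows "ennreal ((\<beta> + 1) * (1 / 2) powr \<beta> / (8 * D powr (\<beta> + 1))) \<le> mean_vacancy x y"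
proof -
  define s where "s = y - x - 1"
  have s: "1 \<le> s" "s \<le> D" "x \<le> y"
    using assms by (auto simp: s_def)
  let ?\<phi> = "\<lambda>u. ennreal (if u \<le> 1 / 2 then u else 0)"
  \<comment> \<open>On this window \<open>u\<close> is at least \<open>1 / 4\<close> and, by
    \<open>1 \<le> s\<close>, \<open>s - u\<close> is at least \<open>1 / 2\<close>; with the width
    \<open>1 / 4\<close> this gives the 16.\<close>
  have "ennreal ((1 / 2) powr \<beta> / 16) = (\<integral>\<^sup>+u. ennreal ((1 / 2) powr \<beta> / 4) * indicator {1/4..1/2::real} u \<partial>lborel)"
    by (subst nn_integral_cmult_indicator) (auto simp: ennreal_mult'[symmetric])
  also have "\<dots> \<le> kernel_integral s ?\<phi>"
    unfolding kernel_integral_def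
  proof (rule nn_integral_mono)
    fix u :: real
    show "ennreal ((1 / 2) powr \<beta> / 4) * indicator {1/4..1/2} u \<le> ?\<phi> u * (ennreal ((s - u) powr \<beta>) * indicator {0..s} u)"
    proof (cases "u \<in> {1/4..1/2}")
      case True
      then have "1 / 4 * (1 / 2) powr \<beta> \<le> u * (s - u) powr \<beta>"
        using s \<beta>_pos by (intro mult_mono powr_mono2) auto
      with True s show ?thesis
        by (auto simp: ennreal_mult'[symmetric] intro!: ennreal_leI)
    qed simp
  qed
  finally have "2 * ennreal ((1 / 2) powr \<beta> / 16) \<le> 2 * kernel_integral s ?\<phi>"
    by (rule mult_left_mono) simp
  also have "\<dots> \<le> mean_vacancy x y * kernel_integral s (\<lambda>_. 1)"
    unfolding s_def using assms s
    by (intro mean_vacancy_lower) (auto simp: mean_vacancy_short)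
  also have "\<dots> \<le> mean_vacancy x y * ennreal (D powr (\<beta> + 1) / (\<beta> + 1))"
    using s \<beta>_pos
    by (subst kernel_integral_one) (auto intro!: mult_left_mono ennreal_leI divide_right_mono powr_mono2)
  finally have "ennreal (D powr (\<beta> + 1) / (\<beta> + 1)) * ennreal ((\<beta> + 1) * (1 / 2) powr \<beta> / (8 * D powr (\<beta> + 1))) \<le>
      ennreal (D powr (\<beta> + 1) / (\<beta> + 1)) * mean_vacancy x y"
    using s \<beta>_pos
    by (simp add: ennreal_mult'[symmetric] mult_ac flip: ennreal_numeral)
  then show ?thesis
    using s \<beta>_pos by (subst (asm) ennreal_mult_le_mult_iff) auto
qed

text \<open>One step of the recursion for the truncated power, divided by the weight
  \<open>s powr (\<beta> + 1) / (\<beta> + 1)\<close>: the Beta factor multiplies the main term, and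
  the cut-off costs a term of order \<open>1 / s\<close>.\<close>

lemma mean_vacancy_ge_step:
  assumes "0 \<le> x" "y \<le> L" "2 \<le> y - x" "0 \<le> \<theta>" "0 \<le> c"
    and IH: "\<And>u v. 0 \<le> u \<Longrightarrow> v \<le> L \<Longrightarrow> 2 \<le> v - u \<Longrightarrow> v - u \<le> y - x - 1 \<Longrightarrow>
      ennreal (c * (v - u) powr \<theta>) \<le> mean_vacancy u v"
  shows "ennreal (c * (2 * (\<beta> + 1) * Beta (\<beta> + 1) (\<theta> + 1) * (y - x - 1) powr \<theta> -
      (\<beta> + 1) * 2 powr (\<theta> + 2) / (y - x - 1))) \<le> mean_vacancy x y"
proof -
  define s where "s = y - x - 1"
  have s: "1 \<le> s" "x \<le> y"
    using assms by (auto simp: s_def)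
  \<comment> \<open>A real value is extracted because the error term is to be subtracted, which
    \<open>ennreal\<close> would truncate at 0.\<close>
  obtain m where m: "mean_vacancy x y = ennreal m" "0 \<le> m"
    using mean_vacancy_le[OF \<open>x \<le> y\<close>] by (metis ennreal_cases ennreal_neq_top top_unique)
  let ?\<phi> = "\<lambda>u. ennreal (if 2 \<le> u then c * u powr \<theta> else 0)"
  have "2 * ennreal (c * (s powr (\<theta> + \<beta> + 1) * Beta (\<beta> + 1) (\<theta> + 1))) \<le>
      2 * (kernel_integral s ?\<phi> + ennreal (c * (2 powr (\<theta> + 1) * s powr \<beta>)))"
    using assms s by (intro mult_left_mono kernel_integral_truncated_powr) auto
  also have "\<dots> = 2 * kernel_integral s ?\<phi> + 2 * ennreal (c * (2 powr (\<theta> + 1) * s powr \<beta>))"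
    by (rule distrib_left)
  also have "2 * kernel_integral s ?\<phi> \<le> mean_vacancy x y * kernel_integral s (\<lambda>_. 1)"
    unfolding s_def using assms s by (intro mean_vacancy_lower) auto
  also have "\<dots> = ennreal (m * (s powr (\<beta> + 1) / (\<beta> + 1)))"
    using s m \<beta>_pos by (simp add: kernel_integral_one ennreal_mult'[symmetric])
  finally have "ennreal (2 * (c * (s powr (\<theta> + \<beta> + 1) * Beta (\<beta> + 1) (\<theta> + 1)))) \<le>
      ennreal (m * (s powr (\<beta> + 1) / (\<beta> + 1)) + 2 * (c * (2 powr (\<theta> + 1) * s powr \<beta>)))"
    using m \<beta>_pos assms by (simp add: ennreal_mult')
  then have "2 * (c * (s powr (\<theta> + \<beta> + 1) * Beta (\<beta> + 1) (\<theta> + 1))) \<le>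
      m * (s powr (\<beta> + 1) / (\<beta> + 1)) + 2 * (c * (2 powr (\<theta> + 1) * s powr \<beta>))"
    using m \<beta>_pos assms by (subst (asm) ennreal_le_iff) auto
  from mult_right_mono[OF this, of "(\<beta> + 1) / s powr (\<beta> + 1)"]
  have "2 * (c * (s powr (\<theta> + \<beta> + 1) * Beta (\<beta> + 1) (\<theta> + 1))) * ((\<beta> + 1) / s powr (\<beta> + 1)) \<le>
      (m * (s powr (\<beta> + 1) / (\<beta> + 1)) + 2 * (c * (2 powr (\<theta> + 1) * s powr \<beta>))) * ((\<beta> + 1) / s powr (\<beta> + 1))"
    using \<beta>_pos by simp
  moreover have "2 * (c * (s powr (\<theta> + \<beta> + 1) * Beta (\<beta> + 1) (\<theta> + 1))) * ((\<beta> + 1) / s powr (\<beta> + 1)) =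
      c * (2 * (\<beta> + 1) * Beta (\<beta> + 1) (\<theta> + 1) * s powr \<theta>)"
    using s by (simp add: powr_add)
  moreover have "(m * (s powr (\<beta> + 1) / (\<beta> + 1)) + 2 * (c * (2 powr (\<theta> + 1) * s powr \<beta>))) * ((\<beta> + 1) / s powr (\<beta> + 1)) =
      m + c * ((\<beta> + 1) * 2 powr (\<theta> + 2) / s)"
    using s \<beta>_pos by (simp add: powr_add distrib_right) (simp add: field_simps)
  ultimately have "c * (2 * (\<beta> + 1) * Beta (\<beta> + 1) (\<theta> + 1) * s powr \<theta>) \<le> m + c * ((\<beta> + 1) * 2 powr (\<theta> + 2) / s)"
    by simp
  then show ?thesis
    unfolding m s_def[symmetric] by (intro ennreal_leI) (simp add: right_diff_distrib)
qed

end

text \<open>After division by \<open>s powr \<theta>\<close> the left side tends to 1 and the right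
  side to \<open>r > 1\<close>: the surplus absorbs both the shift by 1 and the error term.\<close>

lemma eventually_power_dominates_shift:
  fixes r \<theta> E :: real
  assumes "1 < r" "0 < \<theta>"
  shows "eventually (\<lambda>s. (s + 1) powr \<theta> \<le> r * s powr \<theta> - E / s) at_top"
proof -
  have "((\<lambda>s. r - E / s / s powr \<theta> - (1 + 1 / s) powr \<theta>) \<longlongrightarrow> r - 0 - 1 powr \<theta>) at_top"
  proof (intro tendsto_diff tendsto_powr tendsto_const)
    show "((\<lambda>s. E / s / s powr \<theta>) \<longlongrightarrow> 0) at_top" "((\<lambda>s. 1 + 1 / s) \<longlongrightarrow> (1::real)) at_top"
      using assms by real_asymp+
  qed auto
  then have "eventually (\<lambda>s. 0 < r - E / s / s powr \<theta> - (1 + 1 / s) powr \<theta>) at_top"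
    by (rule order_tendstoD) (use assms in auto)
  then show ?thesis
    using eventually_gt_at_top[of 0]
  proof eventually_elim
    case (elim s)
    have "s + 1 = s * (1 + 1 / s)"
      using elim by (simp add: field_simps)
    then have "(s + 1) powr \<theta> = s powr \<theta> * (1 + 1 / s) powr \<theta>"
      using elim by (simp only:) (subst powr_mult, auto)
    moreover have "0 < s powr \<theta> * (r - E / s / s powr \<theta> - (1 + 1 / s) powr \<theta>)"
      using elim by simp
    moreover have "s powr \<theta> * (E / s / s powr \<theta>) = E / s"
      using elim by simp
    ultimately show ?case
      by (simp only: right_diff_distrib mult.commute)
  qed
qed

text \<open>The constant has to be independent of \<open>L\<close>, which finally tends to infinity;
  hence it is fixed outside the locale, which is entered afterwards for each
  \<open>L\<close>.\<close>

lemma mean_vacancy_ge_powr: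
  fixes \<beta> \<theta> :: real
  assumes "\<beta> > 0" "0 < \<theta>" "1 < 2 * (\<beta> + 1) * Beta (\<beta> + 1) (\<theta> + 1)"
  obtains c where "0 < c"
    "\<And>L x y. 1 < L \<Longrightarrow> 0 \<le> x \<Longrightarrow> y \<le> L \<Longrightarrow> 2 \<le> y - x \<Longrightarrow>
      ennreal (c * (y - x) powr \<theta>) \<le> power_rsa.mean_vacancy \<beta> L x y"
proof -
  define r E where "r = 2 * (\<beta> + 1) * Beta (\<beta> + 1) (\<theta> + 1)" and "E = (\<beta> + 1) * 2 powr (\<theta> + 2)"
  obtain s0 where s0: "\<And>s. s \<ge> s0 \<Longrightarrow> (s + 1) powr \<theta> \<le> r * s powr \<theta> - E / s"
    using eventually_power_dominates_shift[of r \<theta> E] assms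
    unfolding r_def eventually_at_top_linorder by blast
  \<comment> \<open>For lengths beyond \<open>D\<close>, the length minus 1 exceeds
    \<open>s0\<close> and the asymptotic inequality applies.\<close>
  define D where "D = max 2 (s0 + 1)"
  \<comment> \<open>Chosen so that \<open>c * D powr \<theta>\<close> is exactly the bound of
    \<open>mean_vacancy_ge_const\<close>; lengths between 2 and \<open>D\<close> are then covered by
    monotonicity.\<close>
  define c where "c = (\<beta> + 1) * (1 / 2) powr \<beta> / (8 * D powr (\<beta> + 1)) / D powr \<theta>"
  have D: "2 \<le> D" "s0 + 1 \<le> D"
    by (auto simp: D_def)
  have c: "0 < c"
    using assms D by (simp add: c_def)
  have "ennreal (c * (y - x) powr \<theta>) \<le> power_rsa.mean_vacancy \<beta> L x y"
    if L: "1 < L" and "y - x \<le> real n" "0 \<le> x" "y \<le> L" "2 \<le> y - x" for L n x y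
  proof -
    interpret power_rsa \<beta> L
      by unfold_locales (use assms L in auto)
    from that(2-) show ?thesis
    proof (induction n arbitrary: x y)
      case (Suc n)
      show ?case
      proof (cases "y - x \<le> D")
        case True
        have "c * (y - x) powr \<theta> \<le> c * D powr \<theta>"
          using True Suc.prems c assms by (intro mult_left_mono powr_mono2) auto
        also have "\<dots> = (\<beta> + 1) * (1 / 2) powr \<beta> / (8 * D powr (\<beta> + 1))"
          using D by (simp add: c_def)
        finally show ?thesis
          using mean_vacancy_ge_const[OF Suc.prems(2-4) True] ennreal_leI order_trans by blast
      next
        case False
        have "c * (y - x - 1 + 1) powr \<theta> \<le> c * (r * (y - x - 1) powr \<theta> - E / (y - x - 1))"
          using False D c by (intro mult_left_mono s0) auto
        moreover have "ennreal (c * (r * (y - x - 1) powr \<theta> - E / (y - x - 1))) \<le> mean_vacancy x y"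
          unfolding r_def E_def by (rule mean_vacancy_ge_step) (use Suc c assms in auto)
        ultimately show ?thesis
          using ennreal_leI order_trans by fastforce
      qed
    qed simp
  qed
  from this[where n = "nat \<lceil>y - x\<rceil>" for x y] that[OF c] show ?thesis
    by (smt (verit) of_nat_ceiling)
qed

section \<open>The Beta function and the exponent\<close>

lemma Beta_real_strict_antimono_right:
  fixes a x y :: real
  assumes "0 < a" "0 < x" "x < y"
  shows "Beta a y < Beta a x"
proof (rule DERIV_neg_imp_decreasing[OF \<open>x < y\<close>])
  fix z assume z: "x \<le> z" "z \<le> y"
  have "0 < Beta a z"
    using assms z by (simp add: Beta_def Gamma_real_pos)
  \<comment> \<open>The logarithmic derivative of \<open>Beta a\<close> at \<open>z\<close> is
    \<open>Digamma z - Digamma (a + z)\<close>, so its sign comes from the growth of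
    \<open>Digamma\<close>.\<close>
  moreover have "Digamma z < Digamma (a + z)"
    using assms z by (intro Digamma_real_strict_mono) auto
  ultimately have "Beta a z * (Digamma z - Digamma (a + z)) < 0"
    by (simp add: mult_less_0_iff)
  moreover have "((\<lambda>y. Beta a y) has_field_derivative Beta a z * (Digamma z - Digamma (a + z))) (at z)"
    using assms z by (intro has_field_derivative_Beta2) (auto elim!: nonpos_Ints_cases)
  ultimately show "\<exists>d. ((\<lambda>y. Beta a y) has_field_derivative d) (at z) \<and> d < 0"
    by blast
qed

lemma Beta_real_one_right:
  assumes "0 < (a :: real)"
  shows "Beta a 1 = 1 / a"
proof -
  have "Gamma (a + 1) = a * Gamma a"
    using assms by (intro Gamma_plus1) (auto elim!: nonpos_Ints_cases)
  with Gamma_real_pos[OF assms] show ?thesis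
    by (simp add: Beta_def)
qed

lemma Beta_real_two_right:
  assumes "0 < (a :: real)"
  shows "Beta a 2 = 1 / (a * (a + 1))"
proof -
  have "(a + 1) * Beta a 2 = 1 / a"
    using Beta_plus1_right[of 1 a] assms by (simp add: Beta_real_one_right)
  then have "Beta a 2 = 1 / a / (a + 1)"
    using assms by (subst nonzero_eq_divide_eq) (auto simp: mult.commute)
  then show ?thesis
    by simp
qed

text \<open>With \<open>a = \<beta> + 1\<close> this is the point \<open>\<theta> = 1\<close>: as
  \<open>a + 1 > 2\<close>, the Beta value is already below the target.\<close>

lemma Beta_real_two_right_less:
  assumes "1 < (a :: real)"
  shows "Beta a 2 < 1 / (2 * a)"
  using assms by (simp add: Beta_real_two_right divide_strict_left_mono)

lemma is_exponent_less_1: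
  assumes "\<beta> > 0" "is_exponent \<beta> \<theta>"
  shows "\<theta> < 1"
proof (rule ccontr)
  assume "\<not> \<theta> < 1"
  then have "Beta (\<beta> + 1) (\<theta> + 1) \<le> Beta (\<beta> + 1) 2"
    using Beta_real_strict_antimono_right[of "\<beta> + 1" 2 "\<theta> + 1"] assms(1) by (cases "\<theta> = 1") auto
  with Beta_real_two_right_less[of "\<beta> + 1"] assms show False
    by (simp add: is_exponent_def)
qed

text \<open>At 0 the Beta value is \<open>1 / (\<beta> + 1)\<close>, twice the target, and at 1 it
  is below the target; intermediate values give existence and strict monotonicity gives
  uniqueness.\<close>

lemma ex1_is_exponent:
  assumes "\<beta> > 0"
  shows "\<exists>!\<theta>. is_exponent \<beta> \<theta>"
proof (rule ex_ex1I)
  let ?f = "\<lambda>\<theta>. Beta (\<beta> + 1) (\<theta> + 1)"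
  have "?f 1 \<le> 1 / (2 * (\<beta> + 1))"
    using Beta_real_two_right_less[of "\<beta> + 1"] assms by simp
  moreover have "1 / (2 * (\<beta> + 1)) < ?f 0"
    using Beta_real_one_right[of "\<beta> + 1"] assms by (simp add: field_simps)
  moreover have "continuous_on {0..1} ?f"
    using assms
    by (intro continuous_at_imp_continuous_on ballI DERIV_isCont[OF DERIV_chain2[OF has_field_derivative_Beta2]])
      (auto intro!: derivative_eq_intros elim!: nonpos_Ints_cases)
  ultimately obtain \<theta> where "0 \<le> \<theta>" "\<theta> \<le> 1" "?f \<theta> = 1 / (2 * (\<beta> + 1))"
    using IVT2'[of ?f 1 "1 / (2 * (\<beta> + 1))" 0] by auto
  moreover from this have "\<theta> \<noteq> 0"
    using \<open>1 / (2 * (\<beta> + 1)) < ?f 0\<close> by auto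
  ultimately show "\<exists>\<theta>. is_exponent \<beta> \<theta>"
    by (intro exI[of _ \<theta>]) (simp add: is_exponent_def)
next
  fix \<theta> \<theta>'
  assume *: "is_exponent \<beta> \<theta>" "is_exponent \<beta> \<theta>'"
  show "\<theta> = \<theta>'"
    using Beta_real_strict_antimono_right[of "\<beta> + 1" "\<theta> + 1" "\<theta>' + 1"]
      Beta_real_strict_antimono_right[of "\<beta> + 1" "\<theta>' + 1" "\<theta> + 1"] * assms
    by (cases \<theta> \<theta>' rule: linorder_cases) (auto simp: is_exponent_def)
qed

lemma is_exponent_Xi: "\<beta> > 0 \<Longrightarrow> is_exponent \<beta> (Xi \<beta>)"
  unfolding Xi_def by (rule theI') (rule ex1_is_exponent)

section \<open>The two bounds for the expected empty space\<close>

lemma expected_space_le: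
  assumes "\<beta> > 0" "L > 0"
  shows "expected_space (power_ldf \<beta>) L \<le> L powr Xi \<beta>"
proof -
  note Xi = is_exponent_Xi[OF \<open>\<beta> > 0\<close>]
  have Xi01: "0 < Xi \<beta>" "Xi \<beta> < 1"
    using Xi is_exponent_less_1[OF \<open>\<beta> > 0\<close> Xi] by (auto simp: is_exponent_def)
  show ?thesis
  proof (cases "L \<le> 1")
    case True
    then show ?thesis
      using powr_mono'[of "Xi \<beta>" 1 L] assms Xi01 by (simp add: expected_space_def)
  next
    case False
    then interpret power_rsa \<beta> L
      by unfold_locales (use assms in auto)
    \<comment> \<open>At \<open>Xi \<beta>\<close> the Beta factor equals 1, the borderline case of
      the upper comparison.\<close>
    have "ennreal (expected_space (power_ldf \<beta>) L) \<le> ennreal ((L - 0) powr Xi \<beta>)"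
      unfolding ennreal_expected_space
      by (rule mean_vacancy_le_powr) (use Xi Xi01 assms in \<open>auto simp: is_exponent_def\<close>)
    then show ?thesis
      by (simp add: ennreal_le_iff)
  qed
qed

text \<open>Below \<open>Xi \<beta>\<close> the Beta factor exceeds 1 by strict monotonicity, and
  the lower comparison is applied to the whole interval \<open>[0, L]\<close>.\<close>

lemma expected_space_ge:
  assumes "\<beta> > 0" "0 < \<theta>" "\<theta> < Xi \<beta>"
  obtains c where "0 < c" "\<And>L. 2 \<le> L \<Longrightarrow> c * L powr \<theta> \<le> expected_space (power_ldf \<beta>) L"
proof -
  have "Beta (\<beta> + 1) (Xi \<beta> + 1) < Beta (\<beta> + 1) (\<theta> + 1)"
    by (rule Beta_real_strict_antimono_right) (use assms in auto)
  then have "1 / (2 * (\<beta> + 1)) < Beta (\<beta> + 1) (\<theta> + 1)"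
    using is_exponent_Xi[OF \<open>\<beta> > 0\<close>] by (simp add: is_exponent_def)
  then have "1 < 2 * (\<beta> + 1) * Beta (\<beta> + 1) (\<theta> + 1)"
    using assms by (subst (asm) pos_divide_less_eq) (auto simp: mult.commute)
  from mean_vacancy_ge_powr[OF assms(1,2) this] obtain c where c: "0 < c"
    "\<And>L x y. 1 < L \<Longrightarrow> 0 \<le> x \<Longrightarrow> y \<le> L \<Longrightarrow> 2 \<le> y - x \<Longrightarrow>
      ennreal (c * (y - x) powr \<theta>) \<le> power_rsa.mean_vacancy \<beta> L x y"
    by blast
  have "c * L powr \<theta> \<le> expected_space (power_ldf \<beta>) L" if "2 \<le> L" for L
  proof -
    interpret power_rsa \<beta> L
      by unfold_locales (use assms that in auto)
    have "ennreal (c * L powr \<theta>) \<le> ennreal (expected_space (power_ldf \<beta>) L)"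
      unfolding ennreal_expected_space using c(2)[of L 0 L] that by simp
    \<comment> \<open>Since \<open>ennreal\<close> sends negative reals to 0, positivity of the
      smaller side is what allows the return to the reals.\<close>
    moreover have "0 < c * L powr \<theta>"
      using c that by simp
    ultimately show ?thesis
      by (auto simp: ennreal_le_iff2)
  qed
  with c(1) show ?thesis
    by (rule that)
qed

theorem theorem6p2:
  fixes \<beta> :: real
  assumes "\<beta> > 0"
  shows "length_distribution (power_ldf \<beta>) \<and>
    (\<exists>!\<theta>. is_exponent \<beta> \<theta>) \<and>
    (\<forall>\<epsilon>>0. (\<lambda>L. L powr (Xi \<beta> - \<epsilon>)) \<in> o[at_top](\<lambda>L. expected_space (power_ldf \<beta>) L)) \<and>
    (\<forall>L>0. expected_space (power_ldf \<beta>) L \<le> L powr Xi \<beta>)"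
proof (intro conjI allI impI)
  show "length_distribution (power_ldf \<beta>)"
    by (rule length_distribution_power_ldf[OF assms])
  show "\<exists>!\<theta>. is_exponent \<beta> \<theta>"
    by (rule ex1_is_exponent[OF assms])
  show "expected_space (power_ldf \<beta>) L \<le> L powr Xi \<beta>" if "L > 0" for L
    by (rule expected_space_le[OF assms that])
next
  fix \<epsilon> :: real assume "\<epsilon> > 0"
  have "Xi \<beta> > 0"
    using is_exponent_Xi[OF assms] by (simp add: is_exponent_def)
  \<comment> \<open>An exponent strictly between \<open>Xi \<beta> - \<epsilon>\<close> and
    \<open>Xi \<beta>\<close>; the maximum keeps it positive when \<open>\<epsilon>\<close> is
    large.\<close>
  define \<theta> where "\<theta> = max (Xi \<beta> - \<epsilon> / 2) (Xi \<beta> / 2)"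
  have \<theta>: "0 < \<theta>" "\<theta> < Xi \<beta>" "Xi \<beta> - \<epsilon> < \<theta>"
    using \<open>Xi \<beta> > 0\<close> \<open>\<epsilon> > 0\<close> by (auto simp: \<theta>_def max_def)
  obtain c where c: "0 < c" "\<And>L. 2 \<le> L \<Longrightarrow> c * L powr \<theta> \<le> expected_space (power_ldf \<beta>) L"
    using expected_space_ge[OF assms \<theta>(1,2)] by blast
  \<comment> \<open>The gap between the two exponents turns the bound up to a constant at
    \<open>\<theta>\<close> into a strict little-o at
    \<open>Xi \<beta> - \<epsilon>\<close>.\<close>
  have "(\<lambda>L. L powr (Xi \<beta> - \<epsilon>)) \<in> o[at_top](\<lambda>L. L powr \<theta>)"
    using \<theta>(3) by real_asymp
  also have "(\<lambda>L. L powr \<theta>) \<in> O[at_top](\<lambda>L. expected_space (power_ldf \<beta>) L)"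
  proof (rule bigoI[where c = "1 / c"])
    show "eventually (\<lambda>L. norm (L powr \<theta>) \<le> 1 / c * norm (expected_space (power_ldf \<beta>) L)) at_top"
      using eventually_ge_at_top[of 2]
    proof eventually_elim
      case (elim L)
      from c(2)[OF elim] have "c * L powr \<theta> \<le> \<bar>expected_space (power_ldf \<beta>) L\<bar>"
        by linarith
      with c(1) show ?case
        by (simp add: field_simps)
    qed
  qed
  finally show "(\<lambda>L. L powr (Xi \<beta> - \<epsilon>)) \<in> o[at_top](\<lambda>L. expected_space (power_ldf \<beta>) L)" .
qed

end
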